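(* Let $\mathcal{A}\in\mathbb{C}^{I_1\times\cdots\times I_M\times J_1\times\cdots\times J_N}$ and $\mathcal{B}\in\mathbb{C}^{J_1\times\cdots\times J_N\times K_1\times\cdots\times K_L}$. Let $\mathcal{M}\in\mathbb{C}^{I_1\times\cdots\times I_M\times I_1\times\cdots\times I_M}$, $\mathcal{N}\in\mathbb{C}^{J_1\times\cdots\times J_N\times J_1\times\cdots\times J_N}$ and $\mathcal{L}\in\mathbb{C}^{K_1\times\cdots\times K_L\times K_1\times\cdots\times K_L}$ be Hermitian positive definite tensors. If $(\mathcal{A}*_N\mathcal{B})^{\dagger}_{\mathcal{M}\mathcal{L}}=\mathcal{B}^{\dagger}_{\mathcal{N}\mathcal{L}}*_N\mathcal{A}^{\dagger}_{\mathcal{M}\mathcal{N}}$, then $\mathcal{A}^{\dagger}_{\mathcal{M}\mathcal{N}}*_M\mathcal{A}$ and $\mathcal{B}*_L\mathcal{B}^{\dagger}_{\mathcal{N}\mathcal{L}}$ commute (with respect to $*_N$).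
   Context: For $\mathcal{A}\in\mathbb{C}^{I_1\times\cdots\times I_M\times J_1\times\cdots\times J_N}$ and $\mathcal{B}\in\mathbb{C}^{J_1\times\cdots\times J_N\times K_1\times\cdots\times K_L}$ the Einstein product $*_N$ (contracting $N$ indices) is $(\mathcal{A}*_N\mathcal{B})_{i_1\cdots i_Mk_1\cdots k_L}=\sum_{j_1,\dots,j_N}a_{i_1\cdots i_Mj_1\cdots j_N}b_{j_1\cdots j_Nk_1\cdots k_L}$; $*_M,*_L,*_K$ are defined likewise. The conjugate transpose is $(\mathcal{A}^H)_{j_1\cdots j_Ni_1\cdots i_M}=\overline{a_{i_1\cdots i_Mj_1\cdots j_N}}$. In $\mathbb{C}^{I_1\times\cdots\times I_K\times I_1\times\cdots\times I_K}$: the identity tensor $\mathcal{I}$ has entries $\prod_k\delta_{i_kj_k}$; $\mathcal{U}$ is unitary if $\mathcal{U}*_K\mathcal{U}^H=\mathcal{U}^H*_K\mathcal{U}=\mathcal{I}$; $\mathcal{D}$ is diagonal if $d_{i_1\cdots i_Kj_1\cdots j_K}=0$ whenever $(i_1,\dots,i_K)\ne(j_1,\dots,j_K)$; $\mathcal{P}$ is Hermitian positive definite if $\mathcal{P}=\mathcal{U}*_K\mathcal{D}*_K\mathcal{U}^H$ with $\mathcal{U}$ unitary and $\mathcal{D}$ diagonal with positive diagonal entries. For any $\mathcal{A}\in\mathbb{C}^{I_1\times\cdots\times I_M\times J_1\times\cdots\times J_N}$ and Hermitian positive definite $\mathcal{S}\in\mathbb{C}^{I_1\times\cdots\times I_M\times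 I_1\times\cdots\times I_M}$, $\mathcal{T}\in\mathbb{C}^{J_1\times\cdots\times J_N\times J_1\times\cdots\times J_N}$: the weighted Moore--Penrose inverse $\mathcal{A}^{\dagger}_{\mathcal{S}\mathcal{T}}$ is the unique $\mathcal{X}\in\mathbb{C}^{J_1\times\cdots\times J_N\times I_1\times\cdots\times I_M}$ satisfying $\mathcal{A}*_N\mathcal{X}*_M\mathcal{A}=\mathcal{A}$, $\mathcal{X}*_M\mathcal{A}*_N\mathcal{X}=\mathcal{X}$, $(\mathcal{S}*_M\mathcal{A}*_N\mathcal{X})^H=\mathcal{S}*_M\mathcal{A}*_N\mathcal{X}$, $(\mathcal{T}*_N\mathcal{X}*_M\mathcal{A})^H=\mathcal{T}*_N\mathcal{X}*_M\mathcal{A}$. *)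

theory Defs
  imports Complex_Main "HOL-Library.FuncSet"
begin

text \<open>
  A complex tensor of order \<open>n\<close> with dimensions \<open>ds = [d1, ..., dn]\<close> is a function on the
  multi-indices \<open>[i1, ..., in]\<close> with \<open>1 \<le> ik \<le> dk\<close>, made extensional (equal to
  \<open>undefined\<close> elsewhere) so that equality of functions is equality of tensors.
  The dimensions \<open>I1, ..., IM, J1, ..., JN\<close> are written \<open>Is @ Js\<close>, so that \<open>M = length Is\<close> and
  \<open>N = length Js\<close>; operations that depend on where the index is split take \<open>Is\<close>, \<open>Js\<close>
  as explicit arguments.
\<close>

type_synonym ctensor = "nat list \<Rightarrow> complex"

definition idx :: "nat list \<Rightarrow> nat list set" where
  "idx ds = listset (map (\<lambda>d. {1..d}) ds)"

definition tensors :: "nat list \<Rightarrow> ctensor set" where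
  "tensors ds = (idx ds \<rightarrow>\<^sub>E UNIV)"

text \<open>
  Einstein product of a tensor with dimensions \<open>Is @ Js\<close> and one with dimensions
  \<open>Js @ Ks\<close>, contracting the indices belonging to \<open>Js\<close>.
\<close>

definition einstein :: "nat list \<Rightarrow> nat list \<Rightarrow> nat list \<Rightarrow> ctensor \<Rightarrow> ctensor \<Rightarrow> ctensor" where
  "einstein Is Js Ks A B =
     (\<lambda>x\<in>idx (Is @ Ks). \<Sum>js\<in>idx Js. A (take (length Is) x @ js) * B (js @ drop (length Is) x))"

text \<open>
  The argument \<open>A\<close> has dimensions \<open>Is @ Js\<close>, the result has dimensions \<open>Js @ Is\<close>.
\<close>

definition conj_transpose :: "nat list \<Rightarrow> nat list \<Rightarrow> ctensor \<Rightarrow> ctensor" where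
  "conj_transpose Is Js A =
     (\<lambda>x\<in>idx (Js @ Is). cnj (A (drop (length Js) x @ take (length Js) x)))"

definition id_tensor :: "nat list \<Rightarrow> ctensor" where
  "id_tensor Is = (\<lambda>x\<in>idx (Is @ Is). \<Prod>k<length Is. of_bool (x ! k = x ! (length Is + k)))"

definition unitary_tensor :: "nat list \<Rightarrow> ctensor \<Rightarrow> bool" where
  "unitary_tensor Is U \<longleftrightarrow>
     U \<in> tensors (Is @ Is) \<and>
     einstein Is Is Is U (conj_transpose Is Is U) = id_tensor Is \<and>
     einstein Is Is Is (conj_transpose Is Is U) U = id_tensor Is"

definition diagonal_tensor :: "nat list \<Rightarrow> ctensor \<Rightarrow> bool" where
  "diagonal_tensor Is D \<longleftrightarrow>
     D \<in> tensors (Is @ Is) \<and>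
     (\<forall>is\<in>idx Is. \<forall>js\<in>idx Is. is \<noteq> js \<longrightarrow> D (is @ js) = 0)"

definition hermitian_pos_def :: "nat list \<Rightarrow> ctensor \<Rightarrow> bool" where
  "hermitian_pos_def Is P \<longleftrightarrow>
     P \<in> tensors (Is @ Is) \<and>
     (\<exists>U D. unitary_tensor Is U \<and> diagonal_tensor Is D \<and>
        (\<forall>is\<in>idx Is. \<exists>r::real. r > 0 \<and> D (is @ is) = complex_of_real r) \<and>
        P = einstein Is Is Is (einstein Is Is Is U D) (conj_transpose Is Is U))"

text \<open>
  \<open>A\<close> has dimensions \<open>Is @ Js\<close>, the weights \<open>S\<close> and \<open>T\<close> have dimensions
  \<open>Is @ Is\<close> and \<open>Js @ Js\<close>.
\<close>

definition is_weighted_mp_inverse ::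
  "nat list \<Rightarrow> nat list \<Rightarrow> ctensor \<Rightarrow> ctensor \<Rightarrow> ctensor \<Rightarrow> ctensor \<Rightarrow> bool" where
  "is_weighted_mp_inverse Is Js S T A X \<longleftrightarrow>
     X \<in> tensors (Js @ Is) \<and>
     einstein Is Is Js (einstein Is Js Is A X) A = A \<and>
     einstein Js Js Is (einstein Js Is Js X A) X = X \<and>
     conj_transpose Is Is (einstein Is Js Is (einstein Is Is Js S A) X) =
       einstein Is Js Is (einstein Is Is Js S A) X \<and>
     conj_transpose Js Js (einstein Js Is Js (einstein Js Js Is T X) A) =
       einstein Js Is Js (einstein Js Js Is T X) A"

definition weighted_mp_inverse ::
  "nat list \<Rightarrow> nat list \<Rightarrow> ctensor \<Rightarrow> ctensor \<Rightarrow> ctensor \<Rightarrow> ctensor" where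
  "weighted_mp_inverse Is Js S T A = (THE X. is_weighted_mp_inverse Is Js S T A X)"

lemma append_in_idx_iff:
  assumes "length xs = length Is"
  shows "xs @ ys \<in> idx (Is @ Js) \<longleftrightarrow> xs \<in> idx Is \<and> ys \<in> idx Js"
  using assms by (induction xs Is rule: list_induct2) (auto simp: idx_def set_Cons_def)

lemma length_idx: "xs \<in> idx ds \<Longrightarrow> length xs = length ds"
  by (induction ds arbitrary: xs) (auto simp: idx_def set_Cons_def)

lemma einstein_entry:
  assumes "is \<in> idx Is" "ks \<in> idx Ks"
  shows "einstein Is Js Ks A B (is @ ks) = (\<Sum>js\<in>idx Js. A (is @ js) * B (js @ ks))"
  using assms by (simp add: einstein_def append_in_idx_iff length_idx)

lemma conj_transpose_entry:
  assumes "is \<in> idx Is" "js \<in> idx Js"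
  shows "conj_transpose Is Js A (js @ is) = cnj (A (is @ js))"
  using assms by (simp add: conj_transpose_def append_in_idx_iff length_idx)

end

theory Submission
  imports Defs "HOL-Library.Function_Algebras"
begin

text \<open>
  Write \<open>P = A\<^sup>\<dagger> A\<close> and \<open>Q = B B\<^sup>\<dagger>\<close>. Both are idempotents with \<open>N P\<close> and \<open>N Q\<close> Hermitian, that is,
  orthogonal projections for the inner product given by \<open>N\<close>. Since \<open>B\<^sup>\<dagger> A\<^sup>\<dagger>\<close> is an inner inverse of
  \<open>A B\<close>, we have \<open>A Q P B = A B\<close>, hence \<open>P Q P Q = P Q\<close>. With \<open>Z = P Q - Q P Q\<close> this gives
  \<open>Z\<^sup>H N Z = 0\<close>, so \<open>P Q = Q P Q\<close> is self-adjoint for \<open>N\<close> and \<open>P Q = Q P\<close>.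

  The weighted inverse is defined by a description operator, so its existence has to be shown too.
  It is \<open>H A G\<close>, where \<open>G\<close> and \<open>H\<close> are inner inverses of \<open>A\<close> with \<open>S A G\<close> and \<open>T H A\<close> Hermitian;
  both come from inner inverses of square tensors.
\<close>

section \<open>Inner inverses of matrices over a field\<close>

lemma sum_apply: "sum f A x = (\<Sum>a\<in>A. f a x)"
  by (induction A rule: infinite_finite_induct) auto

text \<open>The matrix acts as a linear map \<open>f\<close> on functions. A linear \<open>g\<close>
  that inverts \<open>f\<close> from the right on the range of \<open>f\<close> satisfies
  \<open>f g f = f\<close>, and the matrix of \<open>g\<close> is the required inner
  inverse.\<close>

lemma ex_inner_inverse:
  fixes a :: "'i \<Rightarrow> 'j \<Rightarrow> 'k::field"
  assumes "finite I" and "finite J"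
  shows "\<exists>x. \<forall>i\<in>I. \<forall>j\<in>J. (\<Sum>j'\<in>J. a i j' * (\<Sum>i'\<in>I. x j' i' * a i' j)) = a i j"
proof -
  interpret vector_space_pair "\<lambda>(c::'k) (v::'j \<Rightarrow> 'k) j. c * v j" "\<lambda>(c::'k) (v::'i \<Rightarrow> 'k) i. c * v i"
    by unfold_locales (auto simp: fun_eq_iff algebra_simps)
  \<comment> \<open>The map \<open>g\<close> goes in the direction opposite to \<open>f\<close>; its
    linearity rules come from this second interpretation.\<close>
  interpret rev: vector_space_pair "\<lambda>(c::'k) (v::'i \<Rightarrow> 'k) i. c * v i" "\<lambda>(c::'k) (v::'j \<Rightarrow> 'k) j. c * v j"
    by unfold_locales
  \<comment> \<open>The value 0 outside \<open>I\<close> makes each \<open>f (e' j)\<close> a finite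
    combination of the unit vectors \<open>e i\<close> with \<open>i \<in> I\<close>. This lets
    \<open>g (f (e' j))\<close> be computed from the values \<open>g (e i)\<close>.\<close>
  define f where "f v = (\<lambda>i. if i \<in> I then \<Sum>j\<in>J. a i j * v j else 0)" for v
  define e where "e i = (\<lambda>i'. if i' = i then 1 else 0 :: 'k)" for i :: 'i
  define e' where "e' j = (\<lambda>j'. if j' = j then 1 else 0 :: 'k)" for j :: 'j
  have "Vector_Spaces.linear (\<lambda>c v j. c * v j) (\<lambda>c v i. c * v i) f"
    by unfold_locales (auto simp: f_def fun_eq_iff sum.distrib distrib_left sum_distrib_left mult.left_commute)
  from linear_exists_right_inverse_on[OF this vs1.subspace_UNIV]
  obtain g where g: "Vector_Spaces.linear (\<lambda>c v i. c * v i) (\<lambda>c v j. c * v j) g" and fg: "\<And>v. f (g (f v)) = f v"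
    by auto
  have "(\<Sum>j'\<in>J. a i j' * (\<Sum>i'\<in>I. g (e i') j' * a i' j)) = a i j" if "i \<in> I" "j \<in> J" for i j
  proof -
    have f_e': "f (e' j) = (\<lambda>i. if i \<in> I then a i j else 0)"
      using that assms by (auto simp: f_def e'_def fun_eq_iff if_distrib cong: if_cong)
    also have "\<dots> = (\<Sum>i'\<in>I. (\<lambda>i. a i' j * e i' i))"
      using assms by (auto simp: e_def fun_eq_iff sum_apply if_distrib cong: if_cong)
    finally have "g (f (e' j)) = (\<Sum>i'\<in>I. (\<lambda>j'. a i' j * g (e i') j'))"
      by (simp only: rev.linear_sum[OF g] rev.linear_scale[OF g])
    then have "g (f (e' j)) j' = (\<Sum>i'\<in>I. g (e i') j' * a i' j)" for j'
      by (simp add: sum_apply mult.commute)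
    \<comment> \<open>The claim is \<open>f (g (f v)) = f v\<close> for the unit vector
      \<open>v = e' j\<close>, read at coordinate \<open>i\<close>.\<close>
    then show ?thesis
      using fun_cong[OF fg[of "e' j"], of i] fun_cong[OF f_e', of i] that(1) by (simp add: f_def)
  qed
  then show ?thesis
    by (intro exI[of _ "\<lambda>j i. g (e i) j"]) auto
qed

section \<open>Algebra of the Einstein product and the conjugate transpose\<close>

lemma finite_idx [simp]: "finite (idx ds)"
proof (induction ds)
  case (Cons d ds)
  have "idx (d # ds) = (\<lambda>(x, xs). x # xs) ` ({1..d} \<times> idx ds)"
    by (auto simp: idx_def set_Cons_def)
  with Cons show ?case by simp
qed (simp add: idx_def)

lemma einstein_in_tensors [simp]: "einstein Is Js Ks A B \<in> tensors (Is @ Ks)"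
  by (simp add: einstein_def tensors_def)

lemma conj_transpose_in_tensors [simp]: "conj_transpose Is Js A \<in> tensors (Js @ Is)"
  by (simp add: conj_transpose_def tensors_def)

lemma idx_append_cases:
  assumes "x \<in> idx (Is @ Js)"
  obtains "is" js where "x = is @ js" "is \<in> idx Is" "js \<in> idx Js"
proof -
  have "length (take (length Is) x) = length Is"
    using length_idx[OF assms] by simp
  then show ?thesis
    using that[of "take (length Is) x" "drop (length Is) x"] assms
      append_in_idx_iff[of "take (length Is) x" Is "drop (length Is) x" Js] by simp
qed

lemma tensor_eqI:
  assumes "A \<in> tensors (Is @ Js)" and "B \<in> tensors (Is @ Js)"
    and "\<And>is js. is \<in> idx Is \<Longrightarrow> js \<in> idx Js \<Longrightarrow> A (is @ js) = B (is @ js)"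
  shows "A = B"
  using assms(1,2) unfolding tensors_def
  by (rule PiE_ext) (auto elim!: idx_append_cases intro: assms(3))

lemma einstein_assoc:
  "einstein Is Ks Ls (einstein Is Js Ks A B) C = einstein Is Js Ls A (einstein Js Ks Ls B C)"
proof (rule tensor_eqI[OF einstein_in_tensors einstein_in_tensors])
  fix "is" ls assume "is \<in> idx Is" "ls \<in> idx Ls"
  then show "einstein Is Ks Ls (einstein Is Js Ks A B) C (is @ ls) =
      einstein Is Js Ls A (einstein Js Ks Ls B C) (is @ ls)"
    by (simp add: einstein_entry sum_distrib_left sum_distrib_right mult.assoc)
      (rule sum.swap)
qed

lemma conj_transpose_einstein:
  "conj_transpose Is Ks (einstein Is Js Ks A B) =
     einstein Ks Js Is (conj_transpose Js Ks B) (conj_transpose Is Js A)"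
  by (rule tensor_eqI[OF conj_transpose_in_tensors einstein_in_tensors])
    (simp add: einstein_entry conj_transpose_entry cnj_sum mult.commute)

lemma conj_transpose_conj_transpose:
  "A \<in> tensors (Is @ Js) \<Longrightarrow> conj_transpose Js Is (conj_transpose Is Js A) = A"
  by (rule tensor_eqI[OF conj_transpose_in_tensors]) (simp_all add: conj_transpose_entry)

lemma id_tensor_in_tensors [simp]: "id_tensor Is \<in> tensors (Is @ Is)"
  by (simp add: id_tensor_def tensors_def)

lemma id_tensor_entry:
  assumes "is \<in> idx Is" "js \<in> idx Is"
  shows "id_tensor Is (is @ js) = of_bool (is = js)"
proof -
  have len: "length is = length Is" "length js = length Is"
    using assms by (simp_all add: length_idx)
  have "id_tensor Is (is @ js) = (\<Prod>k<length Is. of_bool (is ! k = js ! k))"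
    using assms len by (auto simp: id_tensor_def append_in_idx_iff nth_append intro!: prod.cong)
  also have "\<dots> = of_bool (\<forall>k<length Is. is ! k = js ! k)"
    by (cases "\<forall>k<length Is. is ! k = js ! k") (auto intro!: prod_zero)
  also have "(\<forall>k<length Is. is ! k = js ! k) = (is = js)"
    using len by (auto simp: list_eq_iff_nth_eq)
  finally show ?thesis .
qed

lemma einstein_id_left:
  "A \<in> tensors (Is @ Js) \<Longrightarrow> einstein Is Is Js (id_tensor Is) A = A"
  by (rule tensor_eqI[OF einstein_in_tensors])
    (auto simp: einstein_entry id_tensor_entry of_bool_def if_distrib[of "\<lambda>x. x * _"] cong: if_cong)

lemma einstein_id_right:
  "A \<in> tensors (Is @ Js) \<Longrightarrow> einstein Is Js Js A (id_tensor Js) = A"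
  by (rule tensor_eqI[OF einstein_in_tensors])
    (auto simp: einstein_entry id_tensor_entry of_bool_def if_distrib[of "\<lambda>x. _ * x"] cong: if_cong)

lemma conj_transpose_id: "conj_transpose Is Is (id_tensor Is) = id_tensor Is"
  by (rule tensor_eqI[OF conj_transpose_in_tensors id_tensor_in_tensors])
    (auto simp: conj_transpose_entry id_tensor_entry)

text \<open>With multi-indices as row and column labels, a tensor is a matrix over finite index
  sets, so the matrix result carries over.\<close>

lemma ex_tensor_inner_inverse:
  assumes A: "A \<in> tensors (Is @ Js)"
  obtains X where "X \<in> tensors (Js @ Is)"
    and "einstein Is Js Js A (einstein Js Is Js X A) = A"
proof -
  obtain x where x: "\<And>is js. is \<in> idx Is \<Longrightarrow> js \<in> idx Js \<Longrightarrow>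
      (\<Sum>js'\<in>idx Js. A (is @ js') * (\<Sum>is'\<in>idx Is. x js' is' * A (is' @ js))) = A (is @ js)"
    using ex_inner_inverse[OF finite_idx finite_idx, of Is Js "\<lambda>is js. A (is @ js)"] by blast
  define X where "X = (\<lambda>y\<in>idx (Js @ Is). x (take (length Js) y) (drop (length Js) y))"
  have X: "X \<in> tensors (Js @ Is)"
    by (simp add: X_def tensors_def)
  have [simp]: "X (js @ is) = x js is" if "js \<in> idx Js" "is \<in> idx Is" for js "is"
    using that by (simp add: X_def append_in_idx_iff length_idx)
  have "einstein Is Js Js A (einstein Js Is Js X A) = A"
    by (rule tensor_eqI[OF einstein_in_tensors A]) (simp add: einstein_entry x)
  with X show ?thesis by (rule that)
qed

section \<open>Positive definite tensors as weights\<close>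

text \<open>
  The last clause says that \<open>(Y - Z)\<^sup>H T (Y - Z) = 0\<close> forces \<open>Y = Z\<close>; expanding the product
  avoids introducing sums of tensors.
\<close>

definition definite :: "nat list \<Rightarrow> ctensor \<Rightarrow> bool" where
  "definite Is T \<longleftrightarrow> T \<in> tensors (Is @ Is) \<and> conj_transpose Is Is T = T \<and>
     (\<forall>Js Y Z E. Y \<in> tensors (Is @ Js) \<longrightarrow> Z \<in> tensors (Is @ Js) \<longrightarrow>
        einstein Js Is Js (conj_transpose Is Js Y) (einstein Is Is Js T Y) = E \<longrightarrow>
        einstein Js Is Js (conj_transpose Is Js Y) (einstein Is Is Js T Z) = E \<longrightarrow>
        einstein Js Is Js (conj_transpose Is Js Z) (einstein Is Is Js T Y) = E \<longrightarrow>
        einstein Js Is Js (conj_transpose Is Js Z) (einstein Is Is Js T Z) = E \<longrightarrow> Y = Z)"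

lemma definite_in_tensors: "definite Is T \<Longrightarrow> T \<in> tensors (Is @ Is)"
  and definite_hermitian: "definite Is T \<Longrightarrow> conj_transpose Is Is T = T"
  by (simp_all add: definite_def)

lemma definite_eqI:
  assumes "definite Is T" and "Y \<in> tensors (Is @ Js)" and "Z \<in> tensors (Is @ Js)"
    and "einstein Js Is Js (conj_transpose Is Js Y) (einstein Is Is Js T Y) = E"
    and "einstein Js Is Js (conj_transpose Is Js Y) (einstein Is Is Js T Z) = E"
    and "einstein Js Is Js (conj_transpose Is Js Z) (einstein Is Is Js T Y) = E"
    and "einstein Js Is Js (conj_transpose Is Js Z) (einstein Is Is Js T Z) = E"
  shows "Y = Z"
  using assms unfolding definite_def by blast

lemma diagonal_einstein_entry:
  assumes "diagonal_tensor Is D" and "is \<in> idx Is" and "js \<in> idx Js"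
  shows "einstein Is Is Js D A (is @ js) = D (is @ is) * A (is @ js)"
proof -
  have "einstein Is Is Js D A (is @ js) = (\<Sum>is'\<in>idx Is. D (is @ is') * A (is' @ js))"
    using assms by (simp add: einstein_entry)
  also have "\<dots> = (\<Sum>is'\<in>idx Is. if is' = is then D (is @ is) * A (is @ js) else 0)"
    using assms by (intro sum.cong) (auto simp: diagonal_tensor_def)
  finally show ?thesis using assms by simp
qed

text \<open>The diagonal entries of \<open>(Y - Z)^H D (Y - Z)\<close> are sums of squared moduli of
  entries of \<open>Y - Z\<close> with positive weights, so they vanish only if all these entries
  do.\<close>

lemma definite_diagonal:
  assumes D: "diagonal_tensor Is D"
    and pos: "\<And>is. is \<in> idx Is \<Longrightarrow> \<exists>r::real. r > 0 \<and> D (is @ is) = complex_of_real r"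
  shows "definite Is D"
proof -
  have D_in: "D \<in> tensors (Is @ Is)"
    using D by (simp add: diagonal_tensor_def)
  obtain d :: "nat list \<Rightarrow> real" where d: "\<And>is. is \<in> idx Is \<Longrightarrow> d is > 0"
    and D_d: "\<And>is. is \<in> idx Is \<Longrightarrow> D (is @ is) = complex_of_real (d is)"
    using pos by metis
  have "conj_transpose Is Is D = D"
  proof (rule tensor_eqI[OF conj_transpose_in_tensors D_in])
    fix "is" js assume "is \<in> idx Is" "js \<in> idx Is"
    then show "conj_transpose Is Is D (is @ js) = D (is @ js)"
      using D by (cases "is = js") (auto simp: conj_transpose_entry D_d diagonal_tensor_def)
  qed
  moreover have "Y = Z" if Y: "Y \<in> tensors (Is @ Js)" and Z: "Z \<in> tensors (Is @ Js)"
    and E: "einstein Js Is Js (conj_transpose Is Js Y) (einstein Is Is Js D Y) = E"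
      "einstein Js Is Js (conj_transpose Is Js Y) (einstein Is Is Js D Z) = E"
      "einstein Js Is Js (conj_transpose Is Js Z) (einstein Is Is Js D Y) = E"
      "einstein Js Is Js (conj_transpose Is Js Z) (einstein Is Is Js D Z) = E"
    for Js Y Z E
  proof (rule tensor_eqI[OF Y Z])
    fix "is" js assume is_js: "is \<in> idx Is" "js \<in> idx Js"
    have entry: "einstein Js Is Js (conj_transpose Is Js V) (einstein Is Is Js D W) (js @ js) =
        (\<Sum>is\<in>idx Is. d is * (cnj (V (is @ js)) * W (is @ js)))" for V W
      using is_js by (simp add: einstein_entry[of js] conj_transpose_entry
          diagonal_einstein_entry[OF D] D_d mult.left_commute)
    \<comment> \<open>Expanding the squared modulus gives the diagonal entries of the four products
      in \<open>E\<close>. These are equal and occur with signs +, -, -, +, so they cancel.\<close>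
    have "complex_of_real (\<Sum>is\<in>idx Is. d is * (cmod (Y (is @ js) - Z (is @ js)))\<^sup>2) =
        (\<Sum>is\<in>idx Is. d is * (cnj (Y (is @ js)) * Y (is @ js)))
        - (\<Sum>is\<in>idx Is. d is * (cnj (Y (is @ js)) * Z (is @ js)))
        - (\<Sum>is\<in>idx Is. d is * (cnj (Z (is @ js)) * Y (is @ js)))
        + (\<Sum>is\<in>idx Is. d is * (cnj (Z (is @ js)) * Z (is @ js)))"
      by (simp only: of_real_sum of_real_mult complex_norm_square flip: sum_subtractf sum.distrib)
        (simp add: algebra_simps)
    also have "\<dots> = 0"
      unfolding entry[symmetric] E by simp
    finally have "(\<Sum>is\<in>idx Is. d is * (cmod (Y (is @ js) - Z (is @ js)))\<^sup>2) = 0"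
      by (simp only: of_real_eq_0_iff)
    then have "d is * (cmod (Y (is @ js) - Z (is @ js)))\<^sup>2 = 0"
      using is_js d by (subst (asm) sum_nonneg_eq_0_iff) (auto intro!: mult_nonneg_nonneg simp: less_imp_le)
    then show "Y (is @ js) = Z (is @ js)"
      using d[OF is_js(1)] by simp
  qed
  ultimately show ?thesis
    using D_in by (simp add: definite_def)
qed

text \<open>The products of \<open>Y\<close> and \<open>Z\<close> with weight \<open>U^H D U\<close>
  are those of \<open>U Y\<close> and \<open>U Z\<close> with weight \<open>D\<close>. Hence
  \<open>U Y = U Z\<close>, and the left inverse \<open>V\<close> cancels \<open>U\<close>.\<close>

lemma definite_congruence:
  assumes D: "definite Js D" and U: "U \<in> tensors (Js @ Is)"
    and VU: "einstein Is Js Is V U = id_tensor Is"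
  shows "definite Is (einstein Is Js Is (conj_transpose Js Is U) (einstein Js Js Is D U))"
    (is "definite Is ?T")
proof -
  have "Y = Z" if Y: "Y \<in> tensors (Is @ Ks)" and Z: "Z \<in> tensors (Is @ Ks)"
    and E: "einstein Ks Is Ks (conj_transpose Is Ks Y) (einstein Is Is Ks ?T Y) = E"
      "einstein Ks Is Ks (conj_transpose Is Ks Y) (einstein Is Is Ks ?T Z) = E"
      "einstein Ks Is Ks (conj_transpose Is Ks Z) (einstein Is Is Ks ?T Y) = E"
      "einstein Ks Is Ks (conj_transpose Is Ks Z) (einstein Is Is Ks ?T Z) = E"
    for Ks Y Z E
  proof -
    have "einstein Js Is Ks U Y = einstein Js Is Ks U Z"
      by (rule definite_eqI[OF D einstein_in_tensors einstein_in_tensors, where E = E])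
        (use E in \<open>simp_all add: einstein_assoc conj_transpose_einstein\<close>)
    then have "einstein Is Is Ks (einstein Is Js Is V U) Y = einstein Is Is Ks (einstein Is Js Is V U) Z"
      by (simp add: einstein_assoc)
    then show ?thesis using Y Z by (simp add: VU einstein_id_left)
  qed
  then show ?thesis
    unfolding definite_def
    by (simp add: conj_transpose_einstein einstein_assoc definite_hermitian[OF D]
        conj_transpose_conj_transpose[OF U])
qed

text \<open>The decomposition \<open>U D U^H\<close> is a congruence of the diagonal tensor by
  \<open>U^H\<close>, which has \<open>U\<close> as a left inverse.\<close>

lemma hermitian_pos_def_definite:
  assumes "hermitian_pos_def Is T"
  shows "definite Is T"
proof -
  obtain U D where U: "unitary_tensor Is U" and D: "diagonal_tensor Is D"
    and pos: "\<forall>is\<in>idx Is. \<exists>r::real. r > 0 \<and> D (is @ is) = complex_of_real r"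
    and T: "T = einstein Is Is Is (einstein Is Is Is U D) (conj_transpose Is Is U)"
    using assms by (auto simp: hermitian_pos_def_def)
  have "definite Is D"
    using D pos by (intro definite_diagonal) auto
  then have "definite Is (einstein Is Is Is (conj_transpose Is Is (conj_transpose Is Is U))
      (einstein Is Is Is D (conj_transpose Is Is U)))"
    by (rule definite_congruence[where V = U]) (use U in \<open>simp_all add: unitary_tensor_def\<close>)
  then show ?thesis
    using U by (simp add: T einstein_assoc conj_transpose_conj_transpose unitary_tensor_def)
qed

text \<open>Since \<open>T\<close> is Hermitian, \<open>T Y = T Z\<close> also gives
  \<open>Y^H T = Z^H T\<close>. All four products required by \<open>definite_eqI\<close> therefore
  equal \<open>Y^H T Y\<close>.\<close>

lemma definite_cancel:
  assumes T: "definite Is T" and Y: "Y \<in> tensors (Is @ Js)" and Z: "Z \<in> tensors (Is @ Js)"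
    and eq: "einstein Is Is Js T Y = einstein Is Is Js T Z"
  shows "Y = Z"
proof (rule definite_eqI[OF T Y Z refl])
  let ?c = "conj_transpose Is Js"
  have "conj_transpose Is Js (einstein Is Is Js T Y) = conj_transpose Is Js (einstein Is Is Js T Z)"
    by (simp add: eq)
  then have eqH: "einstein Js Is Is (?c Y) T = einstein Js Is Is (?c Z) T"
    by (simp add: conj_transpose_einstein definite_hermitian[OF T])
  show "einstein Js Is Js (?c Y) (einstein Is Is Js T Z) = einstein Js Is Js (?c Y) (einstein Is Is Js T Y)"
    by (simp add: eq)
  show "einstein Js Is Js (?c Z) (einstein Is Is Js T Y) = einstein Js Is Js (?c Y) (einstein Is Is Js T Y)"
    by (simp add: eqH flip: einstein_assoc)
  then show "einstein Js Is Js (?c Z) (einstein Is Is Js T Z) = einstein Js Is Js (?c Y) (einstein Is Is Js T Y)"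
    by (simp add: eq)
qed

text \<open>Cancelling \<open>T\<close> in \<open>T R T = T\<close> shows that an inner inverse
  \<open>R\<close> is a left inverse. Its conjugate transpose is a right inverse, which forces
  \<open>R^H = R\<close>. The inverse serves as the weight for the conjugate transpose in the
  minimum norm problem.\<close>

lemma definite_inverse:
  assumes T: "definite Is T"
  obtains R where "definite Is R" and "einstein Is Is Is R T = id_tensor Is"
    and "einstein Is Is Is T R = id_tensor Is"
proof -
  note T_in = definite_in_tensors[OF T]
  obtain R where R: "R \<in> tensors (Is @ Is)" and TRT: "einstein Is Is Is T (einstein Is Is Is R T) = T"
    using ex_tensor_inner_inverse[OF T_in] .
  have RT: "einstein Is Is Is R T = id_tensor Is"
    by (rule definite_cancel[OF T, where Js = Is]) (simp_all add: TRT einstein_id_right[OF T_in])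
  have "conj_transpose Is Is (einstein Is Is Is R T) = id_tensor Is"
    by (simp add: RT conj_transpose_id)
  then have TRH: "einstein Is Is Is T (conj_transpose Is Is R) = id_tensor Is"
    by (simp add: conj_transpose_einstein definite_hermitian[OF T])
  have "conj_transpose Is Is R = einstein Is Is Is (einstein Is Is Is R T) (conj_transpose Is Is R)"
    by (simp add: RT einstein_id_left)
  also have "\<dots> = R"
    by (simp add: einstein_assoc TRH einstein_id_right R)
  finally have RH: "conj_transpose Is Is R = R" .
  then have TR: "einstein Is Is Is T R = id_tensor Is"
    using TRH by simp
  \<comment> \<open>\<open>R = R^H T R\<close> is congruent to \<open>T\<close>, and
    \<open>T\<close> is a left inverse of \<open>R\<close>.\<close>
  have "definite Is R"
    using definite_congruence[OF T R TR] by (simp add: RH TR einstein_id_right R)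
  from this RT TR show ?thesis by (rule that)
qed

text \<open>\<open>einstein_assoc\<close> nests products to the right, where \<open>A B\<close> no
  longer occurs as a subterm of \<open>A (B Z)\<close>. This form lets a known product
  \<open>A B = C\<close> be rewritten there.\<close>

lemma einstein_eq_mult:
  "einstein Is Js Ks A B = C \<Longrightarrow>
     einstein Is Js Ls A (einstein Js Ks Ls B Z) = einstein Is Ks Ls C Z"
  by (simp flip: einstein_assoc)

section \<open>Existence and uniqueness of the weighted Moore-Penrose inverse\<close>

text \<open>The weighted least squares solution \<open>(A\<^sup>H S A)\<^sup>- A\<^sup>H S\<close>.\<close>

lemma ex_weighted_least_squares_inverse:
  assumes S: "definite Is S" and A: "A \<in> tensors (Is @ Js)"
  obtains G where "G \<in> tensors (Js @ Is)" and "einstein Is Js Js A (einstein Js Is Js G A) = A"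
    and "conj_transpose Is Is (einstein Is Is Is S (einstein Is Js Is A G)) =
      einstein Is Is Is S (einstein Is Js Is A G)"
proof -
  let ?AH = "conj_transpose Is Js A"
  \<comment> \<open>\<open>C\<close> is the Gram tensor of \<open>A\<close> for the weight
    \<open>S\<close>. It is Hermitian, but its inner inverse \<open>V\<close> may fail to be, so
    \<open>V^H\<close> is treated as a second inner inverse.\<close>
  define C where "C = einstein Js Is Js ?AH (einstein Is Is Js S A)"
  have C: "C \<in> tensors (Js @ Js)"
    by (simp add: C_def)
  have CH: "conj_transpose Js Js C = C"
    by (simp add: C_def conj_transpose_einstein einstein_assoc definite_hermitian[OF S]
        conj_transpose_conj_transpose[OF A])
  obtain V where V: "V \<in> tensors (Js @ Js)" and CVC: "einstein Js Js Js C (einstein Js Js Js V C) = C"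
    using ex_tensor_inner_inverse[OF C] .
  let ?VH = "conj_transpose Js Js V"
  have "conj_transpose Js Js (einstein Js Js Js C (einstein Js Js Js V C)) = C"
    by (simp add: CVC CH)
  then have CVHC: "einstein Js Js Js C (einstein Js Js Js ?VH C) = C"
    by (simp add: conj_transpose_einstein CH einstein_assoc)
  \<comment> \<open>Definiteness of \<open>S\<close> turns \<open>C V C = C\<close> into
    \<open>A V C = A\<close>: the four products of \<open>A V C\<close> and \<open>A\<close> with
    weight \<open>S\<close> all reduce to \<open>C\<close>.\<close>
  have AVC: "einstein Is Js Js A (einstein Js Js Js V C) = A"
  proof (rule definite_eqI[OF S einstein_in_tensors A, where E = C])
    have C_mult: "einstein Js Is Ls ?AH (einstein Is Is Ls S (einstein Is Js Ls A Z)) =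
        einstein Js Js Ls C Z" for Ls Z
      by (simp add: C_def einstein_assoc)
    show "einstein Js Is Js (conj_transpose Is Js (einstein Is Js Js A (einstein Js Js Js V C)))
        (einstein Is Is Js S (einstein Is Js Js A (einstein Js Js Js V C))) = C"
      by (simp add: conj_transpose_einstein einstein_assoc CH C_mult CVC CVHC)
    show "einstein Js Is Js (conj_transpose Is Js (einstein Is Js Js A (einstein Js Js Js V C)))
        (einstein Is Is Js S A) = C"
      by (simp add: conj_transpose_einstein einstein_assoc CH CVHC flip: C_def)
    show "einstein Js Is Js ?AH (einstein Is Is Js S (einstein Is Js Js A (einstein Js Js Js V C))) = C"
      by (simp add: C_mult CVC)
    show "einstein Js Is Js ?AH (einstein Is Is Js S A) = C"
      by (simp add: C_def)
  qed
  define G where "G = einstein Js Js Is V (einstein Js Is Is ?AH S)"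
  have GA: "einstein Js Is Js G A = einstein Js Js Js V C"
    by (simp add: G_def C_def einstein_assoc)
  have "conj_transpose Is Js (einstein Is Js Js A (einstein Js Js Js V C)) = ?AH"
    by (simp add: AVC)
  then have CVHAH: "einstein Js Js Is C (einstein Js Js Is ?VH ?AH) = ?AH"
    by (simp add: conj_transpose_einstein CH einstein_assoc)
  \<comment> \<open>Although \<open>V\<close> may differ from \<open>V^H\<close>, the product
    \<open>A V A^H\<close> is Hermitian: \<open>A V^H A^H = A V C V^H A^H = A V A^H\<close>. This
    makes \<open>S A G = S A V A^H S\<close> Hermitian.\<close>
  have "einstein Is Js Is A (einstein Js Js Is ?VH ?AH) =
      einstein Is Js Is (einstein Is Js Js A (einstein Js Js Js V C)) (einstein Js Js Is ?VH ?AH)"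
    by (simp only: AVC)
  also have "\<dots> = einstein Is Js Is A (einstein Js Js Is V ?AH)"
    by (simp add: einstein_assoc CVHAH)
  finally have VH_V: "einstein Is Js Is A (einstein Js Js Is ?VH ?AH) =
      einstein Is Js Is A (einstein Js Js Is V ?AH)" .
  show ?thesis
  proof (rule that)
    show "G \<in> tensors (Js @ Is)"
      by (simp add: G_def)
    show "einstein Is Js Js A (einstein Js Is Js G A) = A"
      by (simp add: GA AVC)
    show "conj_transpose Is Is (einstein Is Is Is S (einstein Is Js Is A G)) =
        einstein Is Is Is S (einstein Is Js Is A G)"
      by (simp add: G_def conj_transpose_einstein einstein_assoc definite_hermitian[OF S]
          conj_transpose_conj_transpose[OF A] einstein_eq_mult[OF VH_V, unfolded einstein_assoc])
  qed
qed

text \<open>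
  Taking conjugate transposes turns a least squares inverse of \<open>A\<^sup>H\<close> with weight \<open>T\<^sup>-\<^sup>1\<close>
  into a minimum norm inverse of \<open>A\<close> with weight \<open>T\<close>.
\<close>

lemma ex_weighted_minimum_norm_inverse:
  assumes T: "definite Js T" and A: "A \<in> tensors (Is @ Js)"
  obtains H where "H \<in> tensors (Js @ Is)" and "einstein Is Js Js A (einstein Js Is Js H A) = A"
    and "conj_transpose Js Js (einstein Js Js Js T (einstein Js Is Js H A)) =
      einstein Js Js Js T (einstein Js Is Js H A)"
proof -
  let ?AH = "conj_transpose Is Js A"
  obtain R where R: "definite Js R" and RT: "einstein Js Js Js R T = id_tensor Js"
    and TR: "einstein Js Js Js T R = id_tensor Js"
    using definite_inverse[OF T] .
  obtain G where G: "G \<in> tensors (Is @ Js)"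
    and AGA: "einstein Js Is Is ?AH (einstein Is Js Is G ?AH) = ?AH"
    and RAG: "conj_transpose Js Js (einstein Js Js Js R (einstein Js Is Js ?AH G)) =
      einstein Js Js Js R (einstein Js Is Js ?AH G)"
    using ex_weighted_least_squares_inverse[OF R conj_transpose_in_tensors] .
  define H where "H = conj_transpose Is Js G"
  have HH: "conj_transpose Js Is H = G"
    by (simp add: H_def conj_transpose_conj_transpose[OF G])
  have "conj_transpose Js Is (einstein Js Is Is ?AH (einstein Is Js Is G ?AH)) = A"
    by (simp add: AGA conj_transpose_conj_transpose[OF A])
  then have AHA: "einstein Is Js Js A (einstein Js Is Js H A) = A"
    by (simp add: conj_transpose_einstein conj_transpose_conj_transpose[OF A] einstein_assoc H_def)
  have HAR: "einstein Js Is Js H (einstein Is Js Js A R) = einstein Js Js Js R (einstein Js Is Js ?AH G)"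
    using RAG by (simp add: conj_transpose_einstein conj_transpose_conj_transpose[OF A]
        einstein_assoc H_def definite_hermitian[OF R])
  show ?thesis
  proof (rule that)
    show "H \<in> tensors (Js @ Is)"
      by (simp add: H_def)
    show "einstein Is Js Js A (einstein Js Is Js H A) = A"
      by (rule AHA)
    \<comment> \<open>Multiplying \<open>H A R = R A^H G\<close> by \<open>T\<close> on both sides
      removes the inverse weight: \<open>T H A = A^H G T\<close>, which is the conjugate transpose
      of \<open>T H A\<close>.\<close>
    have "einstein Js Js Js T (einstein Js Is Js H A) =
        einstein Js Js Js T (einstein Js Js Js (einstein Js Is Js H (einstein Is Js Js A R)) T)"
      by (simp add: einstein_assoc RT einstein_id_right A)
    also have "\<dots> = einstein Js Js Js (einstein Js Js Js T R) (einstein Js Is Js ?AH (einstein Is Js Js G T))"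
      by (simp add: HAR einstein_assoc)
    also have "\<dots> = conj_transpose Js Js (einstein Js Js Js T (einstein Js Is Js H A))"
      by (simp add: TR einstein_id_left conj_transpose_einstein HH definite_hermitian[OF T] einstein_assoc)
    finally show "conj_transpose Js Js (einstein Js Js Js T (einstein Js Is Js H A)) =
        einstein Js Js Js T (einstein Js Is Js H A)" by simp
  qed
qed

text \<open>For \<open>X = H A G\<close>, the inner inverse equations collapse \<open>A X\<close> to
  \<open>A G\<close> and \<open>X A\<close> to \<open>H A\<close>. The two symmetry conditions are
  thus inherited from \<open>G\<close> and \<open>H\<close> separately.\<close>

lemma ex_weighted_mp_inverse:
  assumes S: "definite Is S" and T: "definite Js T" and A: "A \<in> tensors (Is @ Js)"
  shows "\<exists>X. is_weighted_mp_inverse Is Js S T A X"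
proof -
  obtain G where G: "G \<in> tensors (Js @ Is)" and AGA: "einstein Is Js Js A (einstein Js Is Js G A) = A"
    and SAG: "conj_transpose Is Is (einstein Is Is Is S (einstein Is Js Is A G)) =
      einstein Is Is Is S (einstein Is Js Is A G)"
    using ex_weighted_least_squares_inverse[OF S A] .
  obtain H where H: "H \<in> tensors (Js @ Is)" and AHA: "einstein Is Js Js A (einstein Js Is Js H A) = A"
    and THA: "conj_transpose Js Js (einstein Js Js Js T (einstein Js Is Js H A)) =
      einstein Js Js Js T (einstein Js Is Js H A)"
    using ex_weighted_minimum_norm_inverse[OF T A] .
  show ?thesis
    unfolding is_weighted_mp_inverse_def
    by (rule exI[of _ "einstein Js Is Is H (einstein Is Js Is A G)"])
      (simp add: einstein_assoc AGA AHA SAG THA einstein_eq_mult[OF AHA, unfolded einstein_assoc])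
qed

text \<open>The hypotheses say that \<open>P\<close> and \<open>Q\<close> are self-adjoint for the
  form given by \<open>T\<close>, and taking adjoints reverses a product:
  \<open>Q^H P^H T = Q^H T P = T Q P\<close>.\<close>

lemma hermitian_swap:
  assumes "conj_transpose Is Is (einstein Is Is Is T P) = einstein Is Is Is T P"
    and "conj_transpose Is Is (einstein Is Is Is T Q) = einstein Is Is Is T Q"
    and T: "conj_transpose Is Is T = T"
  shows "conj_transpose Is Is (einstein Is Is Is T (einstein Is Is Is P Q)) =
    einstein Is Is Is T (einstein Is Is Is Q P)"
proof -
  have PH: "einstein Is Is Is (conj_transpose Is Is P) T = einstein Is Is Is T P"
    and QH: "einstein Is Is Is (conj_transpose Is Is Q) T = einstein Is Is Is T Q"
    using assms by (simp_all add: conj_transpose_einstein)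
  show ?thesis
    by (simp add: conj_transpose_einstein T einstein_assoc PH einstein_eq_mult[OF QH])
qed

text \<open>\<open>A X\<close> and \<open>A Y\<close> are self-adjoint for \<open>S\<close>, with
  \<open>A X A Y = A Y\<close> and \<open>A Y A X = A X\<close>. Taking the adjoint of the first
  product therefore gives \<open>A X = A Y\<close>. In the same way \<open>X A = Y A\<close> for the
  weight \<open>T\<close>.\<close>

lemma weighted_mp_inverse_unique:
  assumes S: "definite Is S" and T: "definite Js T"
    and X: "is_weighted_mp_inverse Is Js S T A X" and Y: "is_weighted_mp_inverse Is Js S T A Y"
  shows "X = Y"
proof -
  note simps = is_weighted_mp_inverse_def einstein_assoc
  have AXA: "einstein Is Js Js A (einstein Js Is Js X A) = A"
    and XAX: "einstein Js Is Is X (einstein Is Js Is A X) = X"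
    and SAX: "conj_transpose Is Is (einstein Is Is Is S (einstein Is Js Is A X)) =
      einstein Is Is Is S (einstein Is Js Is A X)"
    and TXA: "conj_transpose Js Js (einstein Js Js Js T (einstein Js Is Js X A)) =
      einstein Js Js Js T (einstein Js Is Js X A)"
    using X unfolding simps by blast+
  have AYA: "einstein Is Js Js A (einstein Js Is Js Y A) = A"
    and YAY: "einstein Js Is Is Y (einstein Is Js Is A Y) = Y"
    and SAY: "conj_transpose Is Is (einstein Is Is Is S (einstein Is Js Is A Y)) =
      einstein Is Is Is S (einstein Is Js Is A Y)"
    and TYA: "conj_transpose Js Js (einstein Js Js Js T (einstein Js Is Js Y A)) =
      einstein Js Js Js T (einstein Js Is Js Y A)"
    using Y unfolding simps by blast+
  have "einstein Is Is Is S (einstein Is Js Is A Y) =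
      conj_transpose Is Is (einstein Is Is Is S (einstein Is Is Is (einstein Is Js Is A X) (einstein Is Js Is A Y)))"
    by (simp add: SAY einstein_assoc einstein_eq_mult[OF AXA, unfolded einstein_assoc])
  also have "\<dots> = einstein Is Is Is S (einstein Is Is Is (einstein Is Js Is A Y) (einstein Is Js Is A X))"
    by (rule hermitian_swap[OF SAX SAY definite_hermitian[OF S]])
  also have "\<dots> = einstein Is Is Is S (einstein Is Js Is A X)"
    by (simp add: einstein_assoc einstein_eq_mult[OF AYA, unfolded einstein_assoc])
  finally have "einstein Is Is Is S (einstein Is Js Is A X) = einstein Is Is Is S (einstein Is Js Is A Y)"
    by (rule sym)
  then have AX_AY: "einstein Is Js Is A X = einstein Is Js Is A Y"
    by (rule definite_cancel[OF S einstein_in_tensors einstein_in_tensors])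
  have "einstein Js Js Js T (einstein Js Is Js X A) =
      conj_transpose Js Js (einstein Js Js Js T (einstein Js Js Js (einstein Js Is Js X A) (einstein Js Is Js Y A)))"
    by (simp add: TXA einstein_assoc AYA)
  also have "\<dots> = einstein Js Js Js T (einstein Js Js Js (einstein Js Is Js Y A) (einstein Js Is Js X A))"
    by (rule hermitian_swap[OF TXA TYA definite_hermitian[OF T]])
  also have "\<dots> = einstein Js Js Js T (einstein Js Is Js Y A)"
    by (simp add: einstein_assoc AXA)
  finally have "einstein Js Js Js T (einstein Js Is Js X A) = einstein Js Js Js T (einstein Js Is Js Y A)" .
  then have XA_YA: "einstein Js Is Js X A = einstein Js Is Js Y A"
    by (rule definite_cancel[OF T einstein_in_tensors einstein_in_tensors])
  \<comment> \<open>The chain is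
    \<open>X = X (A X) = X (A Y) = (X A) Y = (Y A) Y = Y\<close>.\<close>
  have "X = einstein Js Js Is (einstein Js Is Js X A) Y"
    using XAX by (simp add: einstein_assoc AX_AY)
  also have "\<dots> = Y"
    unfolding XA_YA by (simp add: einstein_assoc YAY)
  finally show ?thesis .
qed

lemma weighted_mp_inverse_is_weighted_mp_inverse:
  assumes "definite Is S" and "definite Js T" and "A \<in> tensors (Is @ Js)"
  shows "is_weighted_mp_inverse Is Js S T A (weighted_mp_inverse Is Js S T A)"
proof -
  obtain X where X: "is_weighted_mp_inverse Is Js S T A X"
    using ex_weighted_mp_inverse[OF assms] ..
  show ?thesis
    unfolding weighted_mp_inverse_def
  proof (rule theI[where P = "is_weighted_mp_inverse Is Js S T A", OF X])
    fix Y assume "is_weighted_mp_inverse Is Js S T A Y"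
    from assms(1,2) this X show "Y = X" by (rule weighted_mp_inverse_unique)
  qed
qed

section \<open>Commuting projections and the reverse order law\<close>

lemma hermitian_idempotents_commute:
  assumes T: "definite Is T" and P_in: "P \<in> tensors (Is @ Is)" and Q_in: "Q \<in> tensors (Is @ Is)"
    and TP: "conj_transpose Is Is (einstein Is Is Is T P) = einstein Is Is Is T P"
    and TQ: "conj_transpose Is Is (einstein Is Is Is T Q) = einstein Is Is Is T Q"
    and PP: "einstein Is Is Is P P = P" and QQ: "einstein Is Is Is Q Q = Q"
    and PQPQ: "einstein Is Is Is P (einstein Is Is Is Q (einstein Is Is Is P Q)) = einstein Is Is Is P Q"
  shows "einstein Is Is Is P Q = einstein Is Is Is Q P"
proof -
  let ?PQ = "einstein Is Is Is P Q"
  let ?QPQ = "einstein Is Is Is Q ?PQ"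
  have PH: "einstein Is Is Is (conj_transpose Is Is P) T = einstein Is Is Is T P"
    and QH: "einstein Is Is Is (conj_transpose Is Is Q) T = einstein Is Is Is T Q"
    using TP TQ by (simp_all add: conj_transpose_einstein definite_hermitian[OF T])
  note simps = conj_transpose_einstein einstein_assoc definite_hermitian[OF T] PP QQ PH QH
    einstein_eq_mult[OF PH] einstein_eq_mult[OF QH]
    einstein_eq_mult[OF PP] einstein_eq_mult[OF QQ] PQPQ
  \<comment> \<open>Moving \<open>T\<close> to the left past the adjoints and using
    \<open>P Q P Q = P Q\<close> reduces all four products of \<open>P Q\<close> and
    \<open>Q P Q\<close> to \<open>T Q P Q\<close>.\<close>
  have PQ: "?PQ = ?QPQ"
    by (rule definite_eqI[OF T einstein_in_tensors einstein_in_tensors,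
          where E = "einstein Is Is Is T ?QPQ"])
      (simp_all add: simps)
  \<comment> \<open>\<open>T Q P Q\<close> is Hermitian and equals \<open>T P Q\<close>, whose
    conjugate transpose is \<open>T Q P\<close>. It remains to cancel \<open>T\<close>.\<close>
  have "einstein Is Is Is T ?PQ = einstein Is Is Is T ?QPQ"
    using PQ by simp
  also have "\<dots> = conj_transpose Is Is (einstein Is Is Is T ?QPQ)"
    by (simp add: simps)
  also have "\<dots> = einstein Is Is Is T (einstein Is Is Is Q P)"
    by (simp only: hermitian_swap[OF TP TQ definite_hermitian[OF T]] flip: PQ)
  finally show ?thesis
    by (rule definite_cancel[OF T einstein_in_tensors einstein_in_tensors])
qed

theorem theorem4p13:
  fixes Is Js Ks :: "nat list"
    and \<A> \<B> \<M> \<N> \<L> :: ctensor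
  assumes "\<A> \<in> tensors (Is @ Js)"
    and "\<B> \<in> tensors (Js @ Ks)"
    and "hermitian_pos_def Is \<M>"
    and "hermitian_pos_def Js \<N>"
    and "hermitian_pos_def Ks \<L>"
    and "weighted_mp_inverse Is Ks \<M> \<L> (einstein Is Js Ks \<A> \<B>) =
         einstein Ks Js Is (weighted_mp_inverse Js Ks \<N> \<L> \<B>) (weighted_mp_inverse Is Js \<M> \<N> \<A>)"
  shows "einstein Js Js Js
           (einstein Js Is Js (weighted_mp_inverse Is Js \<M> \<N> \<A>) \<A>)
           (einstein Js Ks Js \<B> (weighted_mp_inverse Js Ks \<N> \<L> \<B>)) =
         einstein Js Js Js
           (einstein Js Ks Js \<B> (weighted_mp_inverse Js Ks \<N> \<L> \<B>))
           (einstein Js Is Js (weighted_mp_inverse Is Js \<M> \<N> \<A>) \<A>)"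
proof -
  note definite = assms(3-5)[THEN hermitian_pos_def_definite]
  define X where "X = weighted_mp_inverse Is Js \<M> \<N> \<A>"
  define Y where "Y = weighted_mp_inverse Js Ks \<N> \<L> \<B>"
  have X: "is_weighted_mp_inverse Is Js \<M> \<N> \<A> X"
    unfolding X_def by (intro weighted_mp_inverse_is_weighted_mp_inverse definite assms)
  have Y: "is_weighted_mp_inverse Js Ks \<N> \<L> \<B> Y"
    unfolding Y_def by (intro weighted_mp_inverse_is_weighted_mp_inverse definite assms)
  \<comment> \<open>The reverse order hypothesis identifies \<open>Y X\<close> as the weighted
    inverse of the product of \<open>\<A>\<close> and \<open>\<B>\<close>; its inner inverse
    equation is extracted next.\<close>
  have "is_weighted_mp_inverse Is Ks \<M> \<L> (einstein Is Js Ks \<A> \<B>) (einstein Ks Js Is Y X)"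
    unfolding X_def Y_def assms(6)[symmetric]
    by (intro weighted_mp_inverse_is_weighted_mp_inverse definite einstein_in_tensors)
  then have AB: "einstein Is Js Ks \<A> (einstein Js Ks Ks \<B> (einstein Ks Js Ks Y
      (einstein Js Is Ks X (einstein Is Js Ks \<A> \<B>)))) = einstein Is Js Ks \<A> \<B>"
    by (simp add: is_weighted_mp_inverse_def einstein_assoc)
  have A: "einstein Is Js Js \<A> (einstein Js Is Js X \<A>) = \<A>"
    and NXA: "conj_transpose Js Js (einstein Js Js Js \<N> (einstein Js Is Js X \<A>)) =
      einstein Js Js Js \<N> (einstein Js Is Js X \<A>)"
    using X by (simp_all add: is_weighted_mp_inverse_def einstein_assoc)
  have B: "einstein Js Ks Ks \<B> (einstein Ks Js Ks Y \<B>) = \<B>"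
    and NBY: "conj_transpose Js Js (einstein Js Js Js \<N> (einstein Js Ks Js \<B> Y)) =
      einstein Js Js Js \<N> (einstein Js Ks Js \<B> Y)"
    using Y by (simp_all add: is_weighted_mp_inverse_def einstein_assoc)
  show ?thesis
    unfolding X_def[symmetric] Y_def[symmetric]
    \<comment> \<open>Here \<open>P = X \<A>\<close> and \<open>Q = \<B> Y\<close>. Facts
      \<open>A\<close> and \<open>B\<close> make them idempotent, and \<open>AB\<close> multiplied
      by \<open>X\<close> on the left and \<open>Y\<close> on the right becomes
      \<open>P Q P Q = P Q\<close>.\<close>
    by (rule hermitian_idempotents_commute[OF definite(2) _ _ NXA NBY])
      (simp_all add: einstein_assoc A einstein_eq_mult[OF B, unfolded einstein_assoc]
        einstein_eq_mult[OF AB, unfolded einstein_assoc])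
qed

end
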